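(* Let $A$ and $B$ be Archimedean semiprime $f$-algebras such that $B$ is relatively uniformly complete, and let $T:A\to B$ be a positive linear operator. Then $T$ is contractive and is an extreme point in the collection of all contractive operators from $A$ to $B$ if and only if $T$ is an algebra homomorphism.
   Context: All spaces are real. A Riesz algebra is a Riesz space with an associative algebra multiplication such that products of positive elements are positive. It is an $f$-algebra if $a\wedge b=0$ implies $ac\wedge b=ca\wedge b=0$ for all $c\ge 0$. An $f$-algebra is semiprime if $0$ is its only nilpotent element. A Riesz space is relatively uniformly complete if every relatively uniformly Cauchy sequence converges relatively uniformly. For an Archimedean semiprime $f$-algebra $A$, $\mathrm{Orth}(A)$ denotes the $f$-algebra of orthomorphisms of $A$, with identity operator $I_A$. $A$ is identified with its image in $\mathrm{Orth}(A)$ under the injective $f$-algebra homomorphism $a\mapsto\pi_a$, $\pi_a(b)=ab$. Thus $A\cap[0,I_A]$ is the set of $0\le a\in A$ with $ab\le b$ for all $0\le b\in A$. A positive linear operator $T:A\to B$ between Archimedean semiprime $f$-algebras is contractive if $Ta\in B\cap[0,I_B]$ whenever $a\in A\cap[0,I_A]$. *)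

theory Defs
  imports
    "HOL-Analysis.Analysis"
    "HOL-Library.Lattice_Algebras"
    "HOL-Library.Function_Algebras"
begin

section \<open>Riesz spaces\<close>

class riesz_space = ordered_real_vector + lattice_ab_group_add_abs
begin

definition ru_Cauchy :: "(nat \<Rightarrow> 'a) \<Rightarrow> bool" where
  "ru_Cauchy f \<longleftrightarrow>
     (\<exists>u\<ge>0. \<forall>\<epsilon>>0. \<exists>N. \<forall>m\<ge>N. \<forall>n\<ge>N. \<bar>f m - f n\<bar> \<le> \<epsilon> *\<^sub>R u)"

definition ru_converges :: "(nat \<Rightarrow> 'a) \<Rightarrow> 'a \<Rightarrow> bool" where
  "ru_converges f x \<longleftrightarrow>
     (\<exists>u\<ge>0. \<forall>\<epsilon>>0. \<exists>N. \<forall>n\<ge>N. \<bar>f n - x\<bar> \<le> \<epsilon> *\<^sub>R u)"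

end

class archimedean_riesz_space = riesz_space +
  assumes archimedean: "(\<And>n::nat. real n *\<^sub>R x \<le> y) \<Longrightarrow> x \<le> 0"

class ru_complete_riesz_space = riesz_space +
  assumes ru_complete: "ru_Cauchy f \<Longrightarrow> \<exists>x. ru_converges f x"

section \<open>f-algebras\<close>

class riesz_algebra = riesz_space + real_algebra + ordered_ring
begin

subclass lattice_ring ..

end

class f_algebra = riesz_algebra +
  assumes f_algebra_right: "inf a b = 0 \<Longrightarrow> 0 \<le> c \<Longrightarrow> inf (a * c) b = 0"
    and f_algebra_left: "inf a b = 0 \<Longrightarrow> 0 \<le> c \<Longrightarrow> inf (c * a) b = 0"

text \<open>
  There need not be a multiplicative unit, so the power operation of the library is not
  available; \<open>(times a ^^ n) a\<close> is the power of \<open>a\<close> with exponent \<open>n + 1\<close>.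
\<close>

class semiprime_f_algebra = f_algebra +
  assumes semiprime: "(times a ^^ n) a = 0 \<Longrightarrow> a = 0"

instance real :: "{archimedean_riesz_space, semiprime_f_algebra}"
proof
  fix a b c x y :: real and n :: nat
  show "x \<le> 0" if *: "\<And>n::nat. real n *\<^sub>R x \<le> y"
  proof (rule ccontr)
    assume "\<not> x \<le> 0"
    then obtain n :: nat where "y < real n * x"
      using reals_Archimedean3[of x] by auto
    with *[of n] show False by simp
  qed
  show "inf (a * c) b = 0" if "inf a b = 0" "0 \<le> c"
    using that by (auto simp: inf_real_def min_def mult_nonneg_nonneg mult_le_0_iff split: if_splits)
  show "inf (c * a) b = 0" if "inf a b = 0" "0 \<le> c"
    using that by (auto simp: inf_real_def min_def mult_nonneg_nonneg mult_le_0_iff split: if_splits)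
  have "(times a ^^ n) a = a ^ Suc n"
    by (induction n) auto
  then show "a = 0" if "(times a ^^ n) a = 0"
    using that by (metis power_not_zero)
qed

instance real :: ru_complete_riesz_space
proof
  fix f :: "nat \<Rightarrow> real"
  assume "ru_Cauchy f"
  then obtain u where u: "u \<ge> 0"
    and C: "\<And>\<epsilon>. \<epsilon> > 0 \<Longrightarrow> \<exists>N. \<forall>m\<ge>N. \<forall>n\<ge>N. \<bar>f m - f n\<bar> \<le> \<epsilon> * u"
    by (auto simp: ru_Cauchy_def)
  have "Cauchy f"
  proof (rule metric_CauchyI)
    fix e :: real assume e: "e > 0"
    have "e / (u + 1) * u < e"
      using u e by (simp add: field_simps)
    moreover obtain N where "\<forall>m\<ge>N. \<forall>n\<ge>N. \<bar>f m - f n\<bar> \<le> e / (u + 1) * u"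
      using C[of "e / (u + 1)"] u e by auto
    ultimately show "\<exists>M. \<forall>m\<ge>M. \<forall>n\<ge>M. dist (f m) (f n) < e"
      unfolding dist_real_def by (meson le_less_trans)
  qed
  then obtain x where lim: "f \<longlonglongrightarrow> x"
    using Cauchy_convergent_iff convergent_def by blast
  have "\<exists>N. \<forall>n\<ge>N. \<bar>f n - x\<bar> \<le> \<epsilon> *\<^sub>R 1" if "\<epsilon> > 0" for \<epsilon>
    using LIMSEQ_D[OF lim that] by (simp, meson less_imp_le)
  then have "ru_converges f x"
    unfolding ru_converges_def by (intro exI[of _ 1]) simp
  then show "\<exists>x. ru_converges f x" ..
qed

section \<open>Orthomorphisms\<close>

definition order_bounded_map :: "('a::riesz_space \<Rightarrow> 'b::riesz_space) \<Rightarrow> bool" where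
  "order_bounded_map T \<longleftrightarrow> (\<forall>l u. \<exists>l' u'. T ` {l..u} \<subseteq> {l'..u'})"

definition Orth :: "('a::riesz_space \<Rightarrow> 'a) set" where
  "Orth = {\<pi>. linear \<pi> \<and> order_bounded_map \<pi> \<and>
     (\<forall>x y. inf (\<bar>x\<bar>) (\<bar>y\<bar>) = 0 \<longrightarrow> inf (\<bar>\<pi> x\<bar>) (\<bar>y\<bar>) = 0)}"

text \<open>
  The operator order compares operators on the positive cone only; it is not the pointwise
  order \<open>(\<le>)\<close> on functions.
\<close>

definition op_le :: "('a::riesz_space \<Rightarrow> 'b::riesz_space) \<Rightarrow> ('a \<Rightarrow> 'b) \<Rightarrow> bool" where
  "op_le S T \<longleftrightarrow> (\<forall>x\<ge>0. S x \<le> T x)"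

text \<open>
  The set \<open>A \<inter> [0, I]\<close>: those \<open>a\<close> whose multiplication operator \<open>\<pi>\<^sub>a = times a\<close> lies in the
  order interval \<open>[0, I]\<close> of \<open>Orth(A)\<close>.
\<close>

definition unit_interval :: "'a::f_algebra set" where
  "unit_interval = {a. times a \<in> Orth \<and> op_le (\<lambda>x. 0) (times a) \<and> op_le (times a) (\<lambda>x. x)}"

lemma inj_times: "inj (times :: 'a::semiprime_f_algebra \<Rightarrow> 'a \<Rightarrow> 'a)"
proof (rule injI)
  fix a b :: 'a assume "times a = times b"
  then have "(a - b) * (a - b) = 0"
    by (metis eq_iff_diff_eq_0 left_diff_distrib)
  then show "a = b"
    using semiprime[where a = "a - b" and n = 1] by simp
qed

lemma times_in_Orth: "times a \<in> Orth" for a :: "'a::f_algebra"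
proof -
  have "linear (times a)"
    by (rule linearI) (simp_all add: distrib_left)
  moreover have "order_bounded_map (times a)"
    unfolding order_bounded_map_def
  proof (intro allI exI subsetI)
    fix l u y assume "y \<in> times a ` {l..u}"
    then obtain x where x: "l \<le> x" "x \<le> u" and y: "y = a * x" by auto
    have y': "y = pprt a * x + nprt a * x"
      unfolding y by (metis distrib_right prts)
    show "y \<in> {pprt a * l + nprt a * u .. pprt a * u + nprt a * l}"
      unfolding y' atLeastAtMost_iff
      by (intro conjI add_mono mult_left_mono mult_left_mono_neg x) auto
  qed
  moreover have "inf (\<bar>a * x\<bar>) (\<bar>y\<bar>) = 0" if "inf (\<bar>x\<bar>) (\<bar>y\<bar>) = 0" for x y
  proof -
    have "inf (\<bar>a * x\<bar>) (\<bar>y\<bar>) \<le> inf (\<bar>a\<bar> * \<bar>x\<bar>) (\<bar>y\<bar>)"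
      by (intro inf_mono abs_le_mult order_refl)
    also have "\<dots> = 0"
      using that by (intro f_algebra_left) auto
    finally show ?thesis by (intro antisym) auto
  qed
  ultimately show ?thesis by (simp add: Orth_def)
qed

lemma unit_interval_iff:
  fixes a :: "'a::semiprime_f_algebra"
  shows "a \<in> unit_interval \<longleftrightarrow> 0 \<le> a \<and> (\<forall>b\<ge>0. a * b \<le> b)"
proof -
  have "0 \<le> a" if *: "\<And>b. 0 \<le> b \<Longrightarrow> 0 \<le> a * b"
  proof -
    define p where "p = pprt a"
    define q where "q = - nprt a"
    have a: "a = p - q" and nonneg: "0 \<le> p" "0 \<le> q"
      by (simp_all add: p_def q_def flip: prts)
    have "inf p q = 0"
    proof -
      have "p - inf p q = sup 0 (p - q)"
        by (simp add: diff_inf_eq_sup add_sup_distrib_left)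
      also have "\<dots> = p"
        by (metis a p_def pprt_def sup_commute)
      finally have "p - inf p q = p" .
      then have "p - (p - inf p q) = p - p" by (rule arg_cong)
      then show ?thesis by (simp only: diff_diff_eq2 add_diff_cancel_left' diff_self)
    qed
    then have "inf (p * q) q = 0"
      using nonneg by (intro f_algebra_right)
    then have "inf q (p * q) = 0"
      by (simp add: inf_commute)
    then have "inf (p * q) (p * q) = 0"
      using nonneg by (intro f_algebra_left)
    then have "a * q = - (q * q)"
      by (simp add: a left_diff_distrib)
    then have "q * q \<le> 0"
      using *[OF nonneg(2)] by simp
    then have "q * q = 0"
      using nonneg by (intro antisym mult_nonneg_nonneg) auto
    then have "q = 0"
      using semiprime[where a = q and n = 1] by simp
    then show ?thesis using a nonneg by simp
  qed
  then show ?thesis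
    by (auto simp: unit_interval_def op_le_def times_in_Orth)
qed

section \<open>Operators\<close>

instantiation "fun" :: (type, real_vector) real_vector
begin

definition scaleR_fun :: "real \<Rightarrow> ('a \<Rightarrow> 'b) \<Rightarrow> 'a \<Rightarrow> 'b" where
  "scaleR_fun r f = (\<lambda>x. r *\<^sub>R f x)"

instance
  by standard (simp_all add: scaleR_fun_def fun_eq_iff algebra_simps)

end

definition positive_operator :: "('a::riesz_space \<Rightarrow> 'b::riesz_space) \<Rightarrow> bool" where
  "positive_operator T \<longleftrightarrow> linear T \<and> (\<forall>x\<ge>0. 0 \<le> T x)"

definition contractive :: "('a::f_algebra \<Rightarrow> 'b::f_algebra) \<Rightarrow> bool" where
  "contractive T \<longleftrightarrow> positive_operator T \<and> T ` unit_interval \<subseteq> unit_interval"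

definition algebra_homomorphism :: "('a::real_algebra \<Rightarrow> 'b::real_algebra) \<Rightarrow> bool" where
  "algebra_homomorphism T \<longleftrightarrow> linear T \<and> (\<forall>x y. T (x * y) = T x * T y)"

end

theory Submission
  imports Defs
begin

text \<open>
  Write \<open>[0, I]\<close> for \<open>unit_interval\<close>. Inequalities between multiplication
  operators are tested on positive elements \<open>y\<close>. The proof has three ingredients.

  \<^item> Truncation. Since \<open>\<mu>\<^sup>2 - 2\<mu>a + a\<^sup>2\<close> is a square, \<open>2\<mu>a - a\<^sup>2 \<le> \<mu>\<^sup>2 I\<close> as multiplication operators
    (\<open>complete_square_nonneg\<close>), so the positive part of \<open>2\<mu>a - a\<^sup>2\<close> is a multiple of an element of
    \<open>[0, I]\<close>, however unbounded \<open>a\<close> is. Divided by \<open>2\<mu>\<close> it lies within \<open>a\<^sup>2/(2\<mu>)\<close> of \<open>a\<close>. Hence a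
    positive operator into an Archimedean space is determined by its values on \<open>[0, I]\<close>
    (\<open>positive_operator_eqI\<close>).

  \<^item> Schwarz inequality. A contractive operator \<open>S\<close> preserves the inequality
    \<open>2\<mu>a - a\<^sup>2 \<le> \<mu>\<^sup>2 I\<close>, and a discriminant argument turns the resulting family
    \<open>2\<mu>(Sa) - S(a\<^sup>2) \<le> \<mu>\<^sup>2 I\<close> into \<open>(Sa)\<^sup>2 \<le> S(a\<^sup>2)\<close> (\<open>contractive_Schwarz\<close>). If a
    homomorphism \<open>T\<close> is a proper convex combination of contractive \<open>S\<close> and \<open>R\<close>, then
    \<open>T(a\<^sup>2) = (Ta)\<^sup>2\<close> and strict convexity of the square force \<open>Sa = Ra\<close> for \<open>a\<close> in \<open>[0, I]\<close>, and
    so \<open>S = R\<close>. That \<open>T\<close> itself is contractive holds because \<open>[0, I]\<close> consists of the \<open>b \<ge> 0\<close>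
    with \<open>b\<^sup>2 \<le> b\<close>, a condition that homomorphisms preserve.

  \<^item> Perturbation. For \<open>a\<close> in \<open>[0, I]\<close> put \<open>D x = T(ax) - (Ta)(Tx)\<close>. Both \<open>T + D\<close> and \<open>T - D\<close> are
    contractive (\<open>contractive_perturbation\<close>), so \<open>D = 0\<close> if \<open>T\<close> is extreme. Thus \<open>T\<close> is
    multiplicative when the left factor is in \<open>[0, I]\<close>; for fixed \<open>x \<ge> 0\<close> both sides are positive
    operators of \<open>a\<close>, and the first ingredient removes the restriction.
\<close>

section \<open>Positive parts and products in f-algebras\<close>

lemma pprt_eqI:
  fixes p q :: "'a::lattice_ab_group_add"
  assumes "inf p q = 0"
  shows "pprt (p - q) = p"
proof -
  have "p - inf p q = sup 0 (p - q)"
    by (simp add: diff_inf_eq_sup add_sup_distrib_left)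
  then show ?thesis using assms by (simp add: pprt_def sup_commute)
qed

lemma pprt_minus_pprt: "x = pprt x - pprt (- x)" for x :: "'a::lattice_ab_group_add"
  by (simp add: pprt_neg flip: prts)

lemma inf_pprt_pprt_minus: "inf (pprt x) (pprt (- x)) = 0" for x :: "'a::lattice_ab_group_add"
proof -
  have "pprt x - inf (pprt x) (pprt (- x)) = sup 0 (pprt x - pprt (- x))"
    by (simp add: diff_inf_eq_sup add_sup_distrib_left)
  also have "\<dots> = pprt x"
    by (metis pprt_minus_pprt pprt_def sup_commute)
  finally show ?thesis by (metis diff_diff_eq2 add_diff_cancel_left' diff_self)
qed

lemma inf_eq_0_mono:
  fixes a b :: "'a::riesz_space"
  assumes "inf a b = 0" "0 \<le> c" "c \<le> a" "0 \<le> d" "d \<le> b"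
  shows "inf c d = 0"
proof (rule antisym)
  show "inf c d \<le> 0"
    using inf_mono[OF assms(3,5)] by (simp add: assms(1))
qed (simp add: assms)

text \<open>
  Multiplying the two factors in turn, the defining property of an f-algebra makes \<open>a b\<close> disjoint first
  from \<open>b\<close> and then from itself.
\<close>
lemma mult_eq_0_if_disjoint:
  fixes a b :: "'a::f_algebra"
  assumes "inf a b = 0"
  shows "a * b = 0"
proof -
  have nonneg: "0 \<le> a" "0 \<le> b"
    using assms by (metis inf_le1 inf_le2)+
  have "inf b (a * b) = 0"
    using f_algebra_right[OF assms nonneg(2)] by (simp add: inf_commute)
  then show ?thesis
    using f_algebra_left[of b "a * b" a] nonneg by simp
qed

lemma square_eq_0_iff: "a * a = 0 \<longleftrightarrow> a = 0" for a :: "'a::semiprime_f_algebra"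
  using semiprime[where a = a and n = 1] by auto

lemma disjoint_if_mult_eq_0:
  fixes a b :: "'a::semiprime_f_algebra"
  assumes "0 \<le> a" "0 \<le> b" "a * b = 0"
  shows "inf a b = 0"
proof -
  have "inf a b * inf a b \<le> a * b"
    using assms by (intro mult_mono) auto
  then have "inf a b * inf a b = 0"
    using assms by (intro antisym mult_nonneg_nonneg) auto
  then show ?thesis by (simp add: square_eq_0_iff)
qed

lemma mult_pprt_left:
  fixes c x :: "'a::f_algebra"
  assumes "0 \<le> c"
  shows "c * pprt x = pprt (c * x)"
proof -
  have "inf (c * pprt x) (c * pprt (- x)) = 0"
    using inf_pprt_pprt_minus[of x] assms
    by (metis f_algebra_left inf_commute)
  then show ?thesis
    by (metis pprt_eqI pprt_minus_pprt right_diff_distrib)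
qed

lemma mult_pprt_right:
  fixes c x :: "'a::f_algebra"
  assumes "0 \<le> c"
  shows "pprt x * c = pprt (x * c)"
proof -
  have "inf (pprt x * c) (pprt (- x) * c) = 0"
    using inf_pprt_pprt_minus[of x] assms
    by (metis f_algebra_right inf_commute)
  then show ?thesis
    by (metis pprt_eqI pprt_minus_pprt left_diff_distrib)
qed

lemma mult_pprt_uminus: "x * pprt (- x) = - (pprt (- x) * pprt (- x))" for x :: "'a::f_algebra"
  using mult_eq_0_if_disjoint[OF inf_pprt_pprt_minus[of x]]
  by (subst (1) pprt_minus_pprt[of x]) (simp add: left_diff_distrib)

lemma pprt_mult_self: "pprt x * x = pprt x * pprt x" for x :: "'a::f_algebra"
  using mult_eq_0_if_disjoint[OF inf_pprt_pprt_minus[of x]]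
  by (metis pprt_minus_pprt right_diff_distrib diff_zero)

lemma nonneg_if_pprt_uminus_eq_0:
  fixes x :: "'a::lattice_ab_group_add"
  assumes "pprt (- x) = 0"
  shows "0 \<le> x"
  using assms by (metis pprt_minus_pprt diff_zero zero_le_pprt)

lemma square_nonneg: "0 \<le> x * x" for x :: "'a::f_algebra"
proof -
  let ?p = "pprt x" and ?q = "pprt (- x)"
  have "?p * ?q = 0" "?q * ?p = 0"
    using inf_pprt_pprt_minus[of x] mult_eq_0_if_disjoint by (metis inf_commute)+
  then have "x * x = ?p * ?p + ?q * ?q"
    by (subst (1 2) pprt_minus_pprt[of x]) (simp add: algebra_simps)
  then show ?thesis by simp
qed

text \<open>The test element is the negative part \<open>q\<close> of \<open>d\<close>, for which \<open>d q = - q\<^sup>2\<close>.\<close>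
lemma nonneg_if_mult_nonneg:
  fixes d :: "'a::semiprime_f_algebra"
  assumes "\<And>y. 0 \<le> y \<Longrightarrow> 0 \<le> d * y"
  shows "0 \<le> d"
proof -
  let ?q = "pprt (- d)"
  have "?q * ?q \<le> 0"
    using assms[of ?q] by (simp add: mult_pprt_uminus)
  then have "?q = 0"
    by (metis square_eq_0_iff antisym square_nonneg)
  then show ?thesis by (rule nonneg_if_pprt_uminus_eq_0)
qed

lemma le_if_mult_le:
  fixes d e :: "'a::semiprime_f_algebra"
  assumes "\<And>y. 0 \<le> y \<Longrightarrow> d * y \<le> e * y"
  shows "d \<le> e"
  using nonneg_if_mult_nonneg[of "e - d"] assms by (simp add: left_diff_distrib)

section \<open>Truncation by completing the square\<close>

text \<open>
  Put \<open>r = inf s t\<close>. Disjointness from \<open>v\<close> gives \<open>r y t = r v y = 0\<close>, so \<open>r y\<close> is disjoint from \<open>t\<close> and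
  hence from \<open>r\<close>, whence \<open>r y = 0\<close>. Thus \<open>r\<close> is disjoint from \<open>y\<close> and bounded by a multiple of \<open>y\<close>.
  In the application \<open>t\<close> and \<open>v\<close> come from the products \<open>a y\<close> and \<open>y a\<close>, whose signs relative to
  \<open>\<mu> y\<close> are to be compared.
\<close>
lemma disjoint_if_intertwined:
  fixes s t v y :: "'a::semiprime_f_algebra"
  assumes "inf s v = 0" "0 \<le> t" "0 \<le> y" "y * t = v * y" and bound: "inf s t \<le> k *\<^sub>R y"
  shows "inf s t = 0"
proof -
  define r where "r = inf s t"
  have sv: "0 \<le> s" "0 \<le> v"
    using assms(1) by (metis inf_le1 inf_le2)+
  have r: "0 \<le> r" "r \<le> s" "r \<le> t"
    using sv assms by (auto simp: r_def)
  have "r * v = 0"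
    using sv r by (intro mult_eq_0_if_disjoint inf_eq_0_mono[OF assms(1)]) auto
  then have "(r * y) * t = 0"
    by (metis mult.assoc mult_zero_left assms(4))
  then have "inf (r * y) t = 0"
    using r assms by (intro disjoint_if_mult_eq_0) auto
  then have "inf r (r * y) = 0"
    using r assms by (subst inf_commute, elim inf_eq_0_mono) auto
  then have "inf (r * y) (r * y) = 0"
    using assms by (intro f_algebra_right)
  then have "r * y = 0" by simp
  moreover have "r * r \<le> r * (k *\<^sub>R y)"
    using r bound by (intro mult_left_mono) (simp_all add: r_def)
  ultimately have "r * r = 0"
    using square_nonneg[of r] by (simp add: antisym)
  then show ?thesis by (simp add: square_eq_0_iff r_def)
qed

text \<open>
  This is \<open>(a - \<mu>)\<^sup>2 \<ge> 0\<close> for the multiplication operator of \<open>a\<close>, applied to \<open>y\<close>. Let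
  \<open>w = a y - \<mu> y\<close>, \<open>w' = y a - \<mu> y\<close>, and let \<open>z = (a - \<mu>)\<^sup>2 y\<close>. Then \<open>y z = w' w\<close>, and
  \<open>w'\<close> and \<open>w\<close> have the same sign everywhere, so \<open>y z \<ge> 0\<close>. Hence the negative part \<open>m\<close> of \<open>z\<close>
  satisfies \<open>y m = 0\<close>. As \<open>z\<close> is the image of \<open>y\<close> under an operator commuting with right
  multiplication, also \<open>z m = 0\<close>, which is \<open>- m\<^sup>2\<close>.
\<close>
lemma complete_square_nonneg:
  fixes a y :: "'a::semiprime_f_algebra"
  assumes "0 \<le> a" "0 \<le> y" "0 \<le> \<mu>"
  shows "(2 * \<mu>) *\<^sub>R (a * y) \<le> a * (a * y) + \<mu>\<^sup>2 *\<^sub>R y"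
proof -
  define w where "w = a * y - \<mu> *\<^sub>R y"
  define w' where "w' = y * a - \<mu> *\<^sub>R y"
  define p where "p = pprt w"
  define q where "q = pprt (- w)"
  define p' where "p' = pprt w'"
  define q' where "q' = pprt (- w')"
  define z where "z = a * w - \<mu> *\<^sub>R w"
  have nonneg: "0 \<le> p" "0 \<le> q" "0 \<le> p'" "0 \<le> q'"
    by (simp_all add: p_def q_def p'_def q'_def)
  have w: "w = p - q" and w': "w' = p' - q'"
    unfolding p_def q_def p'_def q'_def by (rule pprt_minus_pprt)+
  have pq: "inf p q = 0" and pq': "inf p' q' = 0"
    by (simp_all add: p_def q_def p'_def q'_def inf_pprt_pprt_minus)
  have "y * w = w' * y"
    by (simp add: w_def w'_def algebra_simps)
  then have yp: "y * p = p' * y" and yq: "y * q = q' * y"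
    using assms by (simp_all add: p_def q_def p'_def q'_def mult_pprt_left mult_pprt_right)
  have "q \<le> \<mu> *\<^sub>R y" "q' \<le> \<mu> *\<^sub>R y"
    using assms by (auto simp: q_def q'_def pprt_def w_def w'_def scaleR_nonneg_nonneg)
  then have bound: "inf p' q \<le> \<mu> *\<^sub>R y" "inf q' p \<le> \<mu> *\<^sub>R y"
    by (auto intro: le_infI1 le_infI2)
  \<comment> \<open>The mixed products vanish: \<open>w'\<close> and \<open>w\<close> have the same sign.\<close>
  have "p' * q = 0"
    using nonneg pq' yq bound assms
    by (intro mult_eq_0_if_disjoint disjoint_if_intertwined[of p' q' q y \<mu>]) auto
  moreover have "q' * p = 0"
    using nonneg pq' yp bound assms
    by (intro mult_eq_0_if_disjoint disjoint_if_intertwined[of q' p' p y \<mu>])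
      (auto simp: inf_commute)
  ultimately have "w' * w = p' * p + q' * q"
    by (simp add: w w' algebra_simps)
  moreover have "y * z = w' * w"
    by (simp add: z_def w'_def algebra_simps)
  ultimately have "0 \<le> y * z"
    using nonneg by simp
  define m where "m = pprt (- z)"
  have "y * m = 0"
    using \<open>0 \<le> y * z\<close> assms by (simp add: m_def mult_pprt_left pprt_eq_0)
  then have "z * m = 0"
    by (simp add: z_def w_def algebra_simps)
  then have "m = 0"
    by (simp add: m_def mult_pprt_uminus square_eq_0_iff)
  then have "0 \<le> z"
    unfolding m_def by (rule nonneg_if_pprt_uminus_eq_0)
  moreover have "z = a * (a * y) + \<mu>\<^sup>2 *\<^sub>R y - (2 * \<mu>) *\<^sub>R (a * y)"
    by (simp add: z_def w_def algebra_simps power2_eq_square scaleR_2 flip: scaleR_scaleR)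
  ultimately show ?thesis by simp
qed

text \<open>
  In a space without a unit the truncation of \<open>a\<close> at a constant need not exist, but the parabola
  \<open>2\<mu>a - a\<^sup>2\<close>, whose maximum is \<open>\<mu>\<^sup>2\<close>, serves as well.
\<close>
lemma truncation_mem_unit_interval:
  fixes a :: "'a::semiprime_f_algebra"
  assumes "0 \<le> a" "0 < \<mu>"
  shows "(1 / \<mu>\<^sup>2) *\<^sub>R pprt ((2 * \<mu>) *\<^sub>R a - a * a) \<in> unit_interval"
  unfolding unit_interval_iff
proof (intro conjI allI impI)
  let ?f = "pprt ((2 * \<mu>) *\<^sub>R a - a * a)"
  show "0 \<le> (1 / \<mu>\<^sup>2) *\<^sub>R ?f"
    by (simp add: scaleR_nonneg_nonneg)
  fix y :: 'a assume y: "0 \<le> y"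
  have "((2 * \<mu>) *\<^sub>R a - a * a) * y \<le> \<mu>\<^sup>2 *\<^sub>R y"
    using complete_square_nonneg[of a y \<mu>] assms y by (simp add: algebra_simps)
  then have "?f * y \<le> \<mu>\<^sup>2 *\<^sub>R y"
    unfolding mult_pprt_right[OF y] using y by (simp add: pprt_def scaleR_nonneg_nonneg)
  then have "(1 / \<mu>\<^sup>2) *\<^sub>R (?f * y) \<le> (1 / \<mu>\<^sup>2) *\<^sub>R (\<mu>\<^sup>2 *\<^sub>R y)"
    by (intro scaleR_left_mono) auto
  then show "(1 / \<mu>\<^sup>2) *\<^sub>R ?f * y \<le> y"
    using assms by simp
qed

section \<open>Positive operators are determined by the bounded elements\<close>

lemma positive_operator_mono:
  assumes "positive_operator T" "x \<le> y"
  shows "T x \<le> T y"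
proof -
  have "0 \<le> T (y - x)"
    using assms by (auto simp: positive_operator_def)
  then show ?thesis
    using assms by (simp add: positive_operator_def linear_diff)
qed

text \<open>
  With \<open>f\<close> the positive part of \<open>2\<mu>a - a\<^sup>2\<close>, where \<open>2\<mu> = n\<close>, one has \<open>n a - a\<^sup>2 \<le> f \<le> n a\<close> and
  \<open>S f = R f\<close>. Hence \<open>n (S a - R a) \<le> S (a\<^sup>2)\<close> for all \<open>n\<close>.
\<close>
lemma positive_operator_le_if_eq_on_unit_interval:
  fixes S R :: "'a::semiprime_f_algebra \<Rightarrow> 'b::archimedean_riesz_space"
  assumes S: "positive_operator S" and R: "positive_operator R"
    and eq: "\<And>a. a \<in> unit_interval \<Longrightarrow> S a = R a"
    and a: "0 \<le> a"
  shows "S a \<le> R a"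
proof -
  have lin: "linear S" "linear R"
    using S R by (auto simp: positive_operator_def)
  have "real n *\<^sub>R (S a - R a) \<le> S (a * a)" for n :: nat
  proof (cases "n = 0")
    case True
    then show ?thesis
      using S a by (auto simp: positive_operator_def)
  next
    case False
    define \<mu> where "\<mu> = real n / 2"
    have \<mu>: "0 < \<mu>" "2 * \<mu> = real n" using False by (auto simp: \<mu>_def)
    define f where "f = pprt ((2 * \<mu>) *\<^sub>R a - a * a)"
    have "S ((1 / \<mu>\<^sup>2) *\<^sub>R f) = R ((1 / \<mu>\<^sup>2) *\<^sub>R f)"
      using truncation_mem_unit_interval[OF a \<mu>(1)] eq by (simp add: f_def)
    then have eqf: "S f = R f"
      using \<mu> by (simp add: linear_scale[OF lin(1)] linear_scale[OF lin(2)])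
    have "(2 * \<mu>) *\<^sub>R a - a * a \<le> f"
      by (simp add: f_def pprt_def)
    then have "S (real n *\<^sub>R a) \<le> S (f + a * a)"
      using \<mu> by (intro positive_operator_mono[OF S]) (simp add: algebra_simps)
    moreover have "f \<le> (2 * \<mu>) *\<^sub>R a"
      using a \<mu> by (simp add: f_def pprt_def scaleR_nonneg_nonneg)
    then have "R f \<le> R (real n *\<^sub>R a)"
      using \<mu> by (intro positive_operator_mono[OF R]) simp
    ultimately have "real n *\<^sub>R S a \<le> real n *\<^sub>R R a + S (a * a)"
      unfolding linear_scale[OF lin(1)] linear_scale[OF lin(2)] linear_add[OF lin(1)] eqf
      by (meson add_right_mono order_trans)
    then show ?thesis by (simp add: algebra_simps)
  qed
  then have "S a - R a \<le> 0" by (rule archimedean)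
  then show ?thesis by simp
qed

lemma positive_operator_eqI:
  fixes S R :: "'a::semiprime_f_algebra \<Rightarrow> 'b::archimedean_riesz_space"
  assumes "positive_operator S" "positive_operator R"
    and "\<And>a. a \<in> unit_interval \<Longrightarrow> S a = R a"
  shows "S = R"
proof
  fix x
  have pos: "S a = R a" if "0 \<le> a" for a
    using positive_operator_le_if_eq_on_unit_interval[of S R a]
      positive_operator_le_if_eq_on_unit_interval[of R S a] assms that
    by (simp add: antisym)
  have "S (pprt x - pprt (- x)) = R (pprt x - pprt (- x))"
    using assms by (simp add: positive_operator_def linear_diff pos)
  then show "S x = R x"
    by (simp flip: pprt_minus_pprt)
qed

section \<open>A Schwarz inequality for contractive operators\<close>

lemma unit_intervalD:
  fixes a :: "'a::semiprime_f_algebra"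
  assumes "a \<in> unit_interval"
  shows "0 \<le> a" "0 \<le> y \<Longrightarrow> a * y \<le> y"
  using assms by (auto simp: unit_interval_iff)

lemma contractiveD:
  assumes "contractive T"
  shows "positive_operator T" "linear T" "0 \<le> x \<Longrightarrow> 0 \<le> T x"
    "a \<in> unit_interval \<Longrightarrow> T a \<in> unit_interval"
  using assms by (auto simp: contractive_def positive_operator_def)

text \<open>
  The inequality \<open>2\<mu>a - a\<^sup>2 \<le> \<mu>\<^sup>2 I\<close> involves the unit, so \<open>S\<close> cannot be applied to it directly; the
  bound passes to the positive part, which is a multiple of an element of \<open>[0, I]\<close>.
\<close>
lemma contractive_complete_square:
  fixes S :: "'a::semiprime_f_algebra \<Rightarrow> 'b::semiprime_f_algebra"
  assumes S: "contractive S" and "0 \<le> a" "0 \<le> y" "0 \<le> \<mu>"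
  shows "(2 * \<mu>) *\<^sub>R (S a * y) \<le> S (a * a) * y + \<mu>\<^sup>2 *\<^sub>R y"
proof (cases "\<mu> = 0")
  case True
  then show ?thesis
    using assms contractiveD(3)[OF S] by simp
next
  case False
  define f where "f = pprt ((2 * \<mu>) *\<^sub>R a - a * a)"
  have "S ((1 / \<mu>\<^sup>2) *\<^sub>R f) \<in> unit_interval"
    using truncation_mem_unit_interval[of a \<mu>] assms False
    by (intro contractiveD(4)[OF S]) (auto simp: f_def)
  then have "(1 / \<mu>\<^sup>2) *\<^sub>R (S f * y) \<le> y"
    using unit_intervalD(2)[of "S ((1 / \<mu>\<^sup>2) *\<^sub>R f)" y] assms
    by (simp add: linear_scale[OF contractiveD(2)[OF S]])
  then have "\<mu>\<^sup>2 *\<^sub>R ((1 / \<mu>\<^sup>2) *\<^sub>R (S f * y)) \<le> \<mu>\<^sup>2 *\<^sub>R y"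
    by (intro scaleR_left_mono) auto
  then have "S f * y \<le> \<mu>\<^sup>2 *\<^sub>R y"
    using False by simp
  moreover have "S ((2 * \<mu>) *\<^sub>R a - a * a) \<le> S f"
    by (rule positive_operator_mono[OF contractiveD(1)[OF S]]) (simp add: f_def pprt_def)
  then have "S ((2 * \<mu>) *\<^sub>R a - a * a) * y \<le> S f * y"
    using assms by (intro mult_right_mono)
  ultimately have "S ((2 * \<mu>) *\<^sub>R a - a * a) * y \<le> \<mu>\<^sup>2 *\<^sub>R y"
    by simp
  then show ?thesis
    using contractiveD(2)[OF S]
    by (simp add: linear_diff linear_scale left_diff_distrib algebra_simps)
qed

text \<open>
  For functions one would put \<open>\<mu> = b\<close> pointwise. Here the substitution is done by averaging: the
  hypothesis at \<open>\<mu> = k/n\<close> is weighted by the Bernstein polynomial \<open>(n choose k) b\<^sup>k (1 - b)\<^bsup>n-k\<^esup>\<close>, that is,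
  by the binomial distribution with success probability \<open>b\<close>. The mean of \<open>\<mu>\<close> is \<open>b\<close> and its variance
  is \<open>b (1 - b) / n\<close>, so \<open>b\<^sup>2 \<le> c + b (1 - b) / n\<close>, and \<open>n\<close> tends to infinity.
\<close>
lemma square_le_if_discriminant:
  fixes b c :: "'b::{archimedean_riesz_space, semiprime_f_algebra}"
  assumes b: "b \<in> unit_interval"
    and discr: "\<And>\<mu> y. 0 \<le> \<mu> \<Longrightarrow> 0 \<le> y \<Longrightarrow> (2 * \<mu>) *\<^sub>R (b * y) \<le> c * y + \<mu>\<^sup>2 *\<^sub>R y"
  shows "b * b \<le> c"
proof (rule le_if_mult_le)
  fix y :: 'b assume y: "0 \<le> y"
  have "real n *\<^sub>R ((b * b) * y - c * y) \<le> b * y" for n :: nat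
  proof (cases "n = 0")
    case True
    then show ?thesis using y unit_intervalD(1)[OF b] by simp
  next
    case False
    \<comment> \<open>\<open>F m x v\<close> is the mean of \<open>(n\<^sup>2 c - 2 n k b + k\<^sup>2) v\<close> over \<open>k = x + X\<close>, where \<open>X\<close> is binomial with
      \<open>m\<close> trials and success probability \<open>b\<close>.\<close>
    define F where "F m x v = (real n)\<^sup>2 *\<^sub>R (c * v) + x\<^sup>2 *\<^sub>R v + (2 * m * x - 2 * real n * x + m) *\<^sub>R (b * v)
      + (m\<^sup>2 - 2 * real n * m - m) *\<^sub>R (b * (b * v))" for m x :: real and v
    have lin: "F m x (u - v) = F m x u - F m x v" for m x u v
      by (simp add: F_def algebra_simps)
    \<comment> \<open>Condition on the outcome of one more trial.\<close>
    have step: "F (m + 1) x v = F m x (v - b * v) + F m (x + 1) (b * v)" for m x v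
    proof -
      have *: "F m (x + 1) (b * v) - F m x (b * v)
          = (2 * x + 1) *\<^sub>R (b * v) + (2 * m - 2 * real n) *\<^sub>R (b * (b * v))"
        unfolding F_def
        by (simp add: algebra_simps power2_eq_square) (simp flip: scaleR_add_left)
      have "F (m + 1) x v - F m x v
          = (2 * x + 1) *\<^sub>R (b * v) + (2 * m - 2 * real n) *\<^sub>R (b * (b * v))"
        unfolding F_def
        by (simp add: algebra_simps power2_eq_square) (simp flip: scaleR_add_left)
      then have "F (m + 1) x v - F m x v = F m (x + 1) (b * v) - F m x (b * v)"
        using * by simp
      then show ?thesis
        by (simp add: lin diff_eq_eq)
    qed
    have "0 \<le> F (real m) x v" if "0 \<le> x" "0 \<le> v" for m x v
      using that
    proof (induction m arbitrary: x v)
      case 0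
      then have "(real n)\<^sup>2 *\<^sub>R ((2 * (x / n)) *\<^sub>R (b * v))
          \<le> (real n)\<^sup>2 *\<^sub>R (c * v + (x / n)\<^sup>2 *\<^sub>R v)"
        by (intro scaleR_left_mono discr) auto
      then have "(2 * real n * x) *\<^sub>R (b * v) \<le> (real n)\<^sup>2 *\<^sub>R (c * v) + x\<^sup>2 *\<^sub>R v"
        using False by (simp add: scaleR_add_right power_divide power2_eq_square mult_ac)
      then show ?case
        by (simp add: F_def algebra_simps)
    next
      case (Suc m)
      then show ?case
        using step[of "real m" x v] unit_intervalD[OF b]
        by (simp add: add.commute[of 1])
    qed
    from this[of 0 y n] y have "0 \<le> F (real n) 0 y" by simp
    also have "F (real n) 0 y = real n *\<^sub>R (b * y - b * (b * y) - real n *\<^sub>R (b * (b * y) - c * y))"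
      by (simp add: F_def algebra_simps power2_eq_square)
    finally have "0 \<le> b * y - b * (b * y) - real n *\<^sub>R (b * (b * y) - c * y)"
      using False by (simp only: zero_le_scaleR_iff) simp
    then have "real n *\<^sub>R (b * (b * y) - c * y) \<le> b * y - b * (b * y)"
      by (simp only: diff_ge_0_iff_ge)
    also have "\<dots> \<le> b * y"
      using y unit_intervalD(1)[OF b] by simp
    finally show ?thesis by (simp only: mult.assoc)
  qed
  then have "(b * b) * y - c * y \<le> 0" by (rule archimedean)
  then show "b * b * y \<le> c * y" by simp
qed

lemma contractive_Schwarz:
  fixes S :: "'a::semiprime_f_algebra \<Rightarrow> 'b::{archimedean_riesz_space, semiprime_f_algebra}"
  assumes "contractive S" "a \<in> unit_interval"
  shows "S a * S a \<le> S (a * a)"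
  using contractiveD(4)[OF assms] contractive_complete_square[OF assms(1) unit_intervalD(1)[OF assms(2)]]
  by (rule square_le_if_discriminant)

section \<open>Homomorphisms are contractive and extreme\<close>

text \<open>
  Where \<open>b > I\<close> one has \<open>b\<^sup>2 > b\<close>. Accordingly the part \<open>u\<close> of \<open>b c\<close> that exceeds \<open>c\<close> is annihilated by
  \<open>b\<close>, whence \<open>u\<^sup>2 = - u c \<le> 0\<close>.
\<close>
lemma mem_unit_interval_if_square_le:
  fixes b :: "'b::semiprime_f_algebra"
  assumes b: "0 \<le> b" "b * b \<le> b"
  shows "b \<in> unit_interval"
  unfolding unit_interval_iff
proof (intro conjI allI impI b)
  fix c :: 'b assume c: "0 \<le> c"
  define u where "u = pprt (b * c - c)"
  have u: "0 \<le> u" by (simp add: u_def)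
  have "(b * b) * c \<le> b * c"
    using b c by (intro mult_right_mono)
  then have "b * (b * c - c) \<le> 0"
    by (simp add: algebra_simps)
  then have "b * u = 0"
    unfolding u_def mult_pprt_left[OF b(1)] by (simp add: pprt_eq_0)
  then have "(u * b) * (u * b) = 0"
    by (metis mult.assoc mult_zero_left mult_zero_right)
  then have ub: "u * b = 0" by (simp add: square_eq_0_iff)
  have "u * u = u * (b * c - c)"
    by (simp only: u_def pprt_mult_self)
  also have "\<dots> = - (u * c)"
    using ub by (simp add: right_diff_distrib flip: mult.assoc)
  also have "\<dots> \<le> 0"
    using u c by simp
  finally have "u = 0"
    by (metis square_eq_0_iff antisym square_nonneg)
  moreover have "b * c - c \<le> u"
    by (simp add: u_def pprt_def)
  ultimately show "b * c \<le> c" by simp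
qed

lemma contractive_if_algebra_homomorphism:
  fixes T :: "'a::semiprime_f_algebra \<Rightarrow> 'b::semiprime_f_algebra"
  assumes T: "positive_operator T" and hom: "algebra_homomorphism T"
  shows "contractive T"
  unfolding contractive_def
proof (intro conjI T image_subsetI mem_unit_interval_if_square_le)
  fix a :: 'a assume a: "a \<in> unit_interval"
  show "0 \<le> T a"
    using T unit_intervalD(1)[OF a] by (simp add: positive_operator_def)
  have "T (a * a) \<le> T a"
    using unit_intervalD[OF a] by (intro positive_operator_mono[OF T])
  then show "T a * T a \<le> T a"
    using hom by (simp add: algebra_homomorphism_def)
qed

text \<open>
  For \<open>T = (1 - t) S + t R\<close> the Schwarz inequality gives
  \<open>(1 - t) (Sa)\<^sup>2 + t (Ra)\<^sup>2 \<le> T(a\<^sup>2) = (Ta)\<^sup>2\<close>, and the left side exceeds \<open>(Ta)\<^sup>2\<close> by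
  \<open>t (1 - t) (Sa - Ra)\<^sup>2\<close>.
\<close>
lemma extreme_if_algebra_homomorphism:
  fixes T :: "'a::semiprime_f_algebra \<Rightarrow> 'b::{archimedean_riesz_space, semiprime_f_algebra}"
  assumes T: "positive_operator T" and hom: "algebra_homomorphism T"
  shows "T extreme_point_of {S. contractive S}"
  unfolding extreme_point_of_def
proof (intro conjI ballI notI)
  show "T \<in> {S. contractive S}"
    using contractive_if_algebra_homomorphism[OF assms] by simp
  fix S R assume "S \<in> {S. contractive S}" "R \<in> {S. contractive S}" and "T \<in> open_segment S R"
  then have S: "contractive S" and R: "contractive R" by auto
  obtain t where "S \<noteq> R" and t: "0 < t" "t < 1" and Teq: "T = (1 - t) *\<^sub>R S + t *\<^sub>R R"
    using \<open>T \<in> open_segment S R\<close> by (auto simp: in_segment)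
  have "S a = R a" if a: "a \<in> unit_interval" for a
  proof -
    define d where "d = S a - R a"
    have Tx: "T x = (1 - t) *\<^sub>R S x + t *\<^sub>R R x" for x
      unfolding Teq by (simp add: scaleR_fun_def)
    have "(1 - t) *\<^sub>R (S a * S a) + t *\<^sub>R (R a * R a) \<le> T (a * a)"
      unfolding Tx using t a S R by (intro add_mono scaleR_left_mono contractive_Schwarz) auto
    also have "T (a * a) = T a * T a"
      using hom by (simp add: algebra_homomorphism_def)
    also have "(1 - t) *\<^sub>R (S a * S a) + t *\<^sub>R (R a * R a) = T a * T a + (t * (1 - t)) *\<^sub>R (d * d)"
      unfolding Tx d_def by (simp add: algebra_simps)
    finally have "(t * (1 - t)) *\<^sub>R (d * d) \<le> 0" by simp
    then have "d * d \<le> 0"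
      using t scaleR_le_cancel_left_pos[of "t * (1 - t)" "d * d" 0] by simp
    then have "d = 0"
      by (metis square_eq_0_iff antisym square_nonneg)
    then show ?thesis by (simp add: d_def)
  qed
  then have "S = R"
    using S R by (intro positive_operator_eqI contractiveD(1))
  then show False using \<open>S \<noteq> R\<close> by simp
qed

section \<open>Extreme contractive operators are homomorphisms\<close>

lemma mult_le_left_if_unit_interval:
  fixes a x :: "'a::semiprime_f_algebra"
  assumes "0 \<le> a" "x \<in> unit_interval"
  shows "a * x \<le> a"
proof (rule le_if_mult_le)
  fix y :: 'a assume "0 \<le> y"
  then have "a * (x * y) \<le> a * y"
    by (intro mult_left_mono[OF _ assms(1)] unit_intervalD(2)[OF assms(2)])
  then show "a * x * y \<le> a * y" by (simp only: mult.assoc)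
qed

text \<open>The element is \<open>I - (I - a) (I - x)\<close>, and both factors are at least \<open>0\<close>.\<close>
lemma circle_mem_unit_interval:
  fixes a x :: "'a::semiprime_f_algebra"
  assumes a: "a \<in> unit_interval" and x: "x \<in> unit_interval"
  shows "a + x - a * x \<in> unit_interval"
  unfolding unit_interval_iff
proof (intro conjI allI impI)
  have "a * x \<le> x"
    by (rule unit_intervalD(2)[OF a unit_intervalD(1)[OF x]])
  then have "0 \<le> a + (x - a * x)"
    using unit_intervalD(1)[OF a] by (intro add_nonneg_nonneg) auto
  then show "0 \<le> a + x - a * x" by (simp only: add_diff_eq)
  fix y :: 'a assume "0 \<le> y"
  then have "0 \<le> y - x * y"
    using unit_intervalD(2)[OF x] by simp
  then have "a * (y - x * y) \<le> y - x * y"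
    by (rule unit_intervalD(2)[OF a])
  then show "(a + x - a * x) * y \<le> y"
    by (simp add: algebra_simps)
qed

text \<open>
  Positivity: \<open>T x + T(ax) - (Ta)(Tx) = T(ax) + (I - Ta)(Tx)\<close> and
  \<open>T x - T(ax) + (Ta)(Tx) = T((I - a)x) + (Ta)(Tx)\<close>. For \<open>x\<close> in \<open>[0, I]\<close> the first is at most
  \<open>Ta + Tx - (Ta)(Tx)\<close> because \<open>a x \<le> a\<close>, and the second at most \<open>T(a + x - ax)\<close> because
  \<open>(Ta)(Tx) \<le> Ta\<close>; both bounds are in \<open>[0, I]\<close> by the previous lemma.
\<close>
lemma contractive_perturbation:
  fixes T :: "'a::semiprime_f_algebra \<Rightarrow> 'b::semiprime_f_algebra"
  assumes T: "contractive T" and a: "a \<in> unit_interval"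
  shows "contractive (\<lambda>x. T x + (T (a * x) - T a * T x))" (is "contractive ?P")
    and "contractive (\<lambda>x. T x - (T (a * x) - T a * T x))" (is "contractive ?M")
proof -
  note lin = contractiveD(2)[OF T] and pos = contractiveD(3)[OF T]
  note Ta = contractiveD(4)[OF T a]
  have lP: "linear ?P" and lM: "linear ?M"
    by (rule linearI; simp add: linear_add[OF lin] linear_scale[OF lin] algebra_simps)+
  have aux: "0 \<le> T (a * x)" "T (a * x) \<le> T x" "0 \<le> T a * T x" "T a * T x \<le> T x"
    if "0 \<le> x" for x
    using unit_intervalD(1)[OF a] unit_intervalD(1)[OF Ta] that
    by (auto intro!: pos positive_operator_mono[OF contractiveD(1)[OF T]] mult_nonneg_nonneg
        unit_intervalD(2)[OF a] unit_intervalD(2)[OF Ta])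
  have pP: "0 \<le> ?P x" if "0 \<le> x" for x
    using aux[OF that] add_nonneg_nonneg[of "T x - T a * T x" "T (a * x)"]
    by (simp add: algebra_simps)
  have pM: "0 \<le> ?M x" if "0 \<le> x" for x
    using aux[OF that] add_nonneg_nonneg[of "T x - T (a * x)" "T a * T x"]
    by (simp add: algebra_simps)
  have bP: "?P x \<in> unit_interval" if x: "x \<in> unit_interval" for x
    unfolding unit_interval_iff
  proof (intro conjI allI impI)
    note Tx = contractiveD(4)[OF T x]
    show "0 \<le> ?P x" using pP unit_intervalD(1)[OF x] by blast
    have "a * x \<le> a"
      by (rule mult_le_left_if_unit_interval[OF unit_intervalD(1)[OF a] x])
    then have "T (a * x) \<le> T a"
      by (rule positive_operator_mono[OF contractiveD(1)[OF T]])
    then have "?P x \<le> T a + T x - T a * T x"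
      by (simp add: algebra_simps)
    moreover fix y :: 'b assume y: "0 \<le> y"
    ultimately have "?P x * y \<le> (T a + T x - T a * T x) * y"
      by (intro mult_right_mono)
    also have "\<dots> \<le> y"
      using circle_mem_unit_interval[OF Ta Tx] y by (rule unit_intervalD(2))
    finally show "?P x * y \<le> y" .
  qed
  have bM: "?M x \<in> unit_interval" if x: "x \<in> unit_interval" for x
    unfolding unit_interval_iff
  proof (intro conjI allI impI)
    note Tx = contractiveD(4)[OF T x]
    show "0 \<le> ?M x" using pM unit_intervalD(1)[OF x] by blast
    have "T a * T x \<le> T a"
      by (rule mult_le_left_if_unit_interval[OF unit_intervalD(1)[OF Ta] Tx])
    then have "?M x \<le> T (a + x - a * x)"
      by (simp add: linear_add[OF lin] linear_diff[OF lin] algebra_simps)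
    moreover fix y :: 'b assume y: "0 \<le> y"
    ultimately have "?M x * y \<le> T (a + x - a * x) * y"
      by (intro mult_right_mono)
    also have "\<dots> \<le> y"
      using contractiveD(4)[OF T circle_mem_unit_interval[OF a x]] y by (rule unit_intervalD(2))
    finally show "?M x * y \<le> y" .
  qed
  show "contractive ?P" "contractive ?M"
    using lP lM pP pM bP bM by (auto simp: contractive_def positive_operator_def)
qed

lemma extreme_point_symmetric_perturbation:
  fixes x d :: "'a::real_vector"
  assumes "x extreme_point_of S" "x + d \<in> S" "x - d \<in> S"
  shows "d = 0"
proof (rule ccontr)
  assume "d \<noteq> 0"
  then have "x \<in> open_segment (x + d) (x - d)"
    unfolding in_segment
  proof (intro conjI exI[of _ "1/2"])
    show "x + d \<noteq> x - d"
    proof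
      assume "x + d = x - d"
      then have "d + d = 0" by (simp add: algebra_simps eq_neg_iff_add_eq_0)
      then show False using \<open>d \<noteq> 0\<close> by (metis scaleR_2 scaleR_eq_0_iff zero_neq_numeral)
    qed
  qed (auto simp: algebra_simps simp flip: scaleR_add_left)
  then show False using assms by (auto simp: extreme_point_of_def)
qed

lemma algebra_homomorphism_if_extreme:
  fixes T :: "'a::semiprime_f_algebra \<Rightarrow> 'b::{archimedean_riesz_space, semiprime_f_algebra}"
  assumes ext: "T extreme_point_of {S. contractive S}"
  shows "algebra_homomorphism T"
proof -
  have T: "contractive T" using ext by (simp add: extreme_point_of_def)
  note lin = contractiveD(2)[OF T] and pos = contractiveD(3)[OF T]
  have unit: "T (a * x) = T a * T x" if a: "a \<in> unit_interval" for a x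
  proof -
    have "(\<lambda>x. T (a * x) - T a * T x) = 0"
      using contractive_perturbation[OF T a]
      by (intro extreme_point_symmetric_perturbation[OF ext])
        (simp_all add: plus_fun_def fun_diff_def)
    then show ?thesis by (simp add: fun_eq_iff)
  qed
  have pos_mult: "T (a * x) = T a * T x" if x: "0 \<le> x" for a x
  proof -
    have "(\<lambda>a. T (a * x)) = (\<lambda>a. T a * T x)"
    proof (rule positive_operator_eqI)
      show "positive_operator (\<lambda>a. T (a * x))" "positive_operator (\<lambda>a. T a * T x)"
        using x pos unfolding positive_operator_def
        by (auto intro!: linearI simp: linear_add[OF lin] linear_scale[OF lin] distrib_right)
    qed (rule unit)
    then show ?thesis by (rule fun_cong)
  qed
  have "T (a * x) = T a * T x" for a x
  proof -
    have "T (a * (pprt x - pprt (- x))) = T a * T (pprt x - pprt (- x))"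
      by (simp add: right_diff_distrib linear_diff[OF lin] pos_mult)
    then show ?thesis by (simp flip: pprt_minus_pprt)
  qed
  then show ?thesis using lin by (simp add: algebra_homomorphism_def)
qed

theorem proposition7:
  fixes T :: "'a::{archimedean_riesz_space, semiprime_f_algebra} \<Rightarrow>
              'b::{archimedean_riesz_space, semiprime_f_algebra, ru_complete_riesz_space}"
  assumes "positive_operator T"
  shows "contractive T \<and> T extreme_point_of {S. contractive S} \<longleftrightarrow> algebra_homomorphism T"
  using assms contractive_if_algebra_homomorphism extreme_if_algebra_homomorphism
    algebra_homomorphism_if_extreme
  by blast

end
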